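(* A tree $T$ belongs to the family $\mathcal{T}_{\rm max}$ if and only if $T$ belongs to the family $\mathcal{T}$.
   Context: Graphs are finite, simple and undirected. $N_G(v)$ is the set of neighbors of $v$. A leaf is a vertex of degree one; a support vertex is a vertex adjacent to at least one leaf; $L_G$ and $S_G$ denote the sets of leaves and of support vertices of $G$ (in $K_2$ both vertices are both leaves and supports). $\gamma(G)$ is the domination number, i.e. the minimum cardinality of a set $D\subseteq V_G$ such that every vertex in $V_G-D$ has a neighbor in $D$. A vertex $v$ of $G$ is $\gamma^-$-critical if $\gamma(G-v)<\gamma(G)$. $\mathcal{T}_{\rm max}$ is the set of trees $T$ for which $\gamma(T)$ equals the cardinality of the smaller of the two partite sets of $T$. $\mathcal{T}$ is the family of trees $T$ (up to isomorphism) that can be obtained from a sequence of trees $T_0,\ldots,T_k$, $k\ge 0$, where $T_0=K_2$ with an arbitrarily chosen (ordered) bipartition of its two-element vertex set, $T=T_k$, and, if $k\ge 1$, for each $i=1,\ldots,k$ the tree $T_i$ is obtained from $T'=T_{i-1}$ with ordered bipartition $(A',B')$ by one of the following four operations. After each operation, a new vertex called $a$ (if any) is put into the first partite set and a new vertex called $b$ (if any) is put into the second partite set, giving the ordered bipartition of $T_i$. $\mathcal{O}_1$: Add a new vertex $b$ to $T'$ and join $b$ to a vertex $a'\in A'$. $\mathcal{O}_2$: Add a new vertex $a$ to $T'$ and join $a$ to a vertex $b'\in B'$ such that $N_{T'}(b')\subseteq S_{T'}$ and $b'\notin L_{T'}$. $\mathcal{O}_3$: Add two new vertices $a$ and $b$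 to $T'$ and join $b$ to $a$ and to a vertex $a'\in A'$ that is a support vertex of $T'$. $\mathcal{O}_4$: Add two new vertices $a$ and $b$ to $T'$ and join $a$ to $b$ and to a vertex $b'\in B'$ which is not a $\gamma^-$-critical vertex of $T'$. *)

theory Defs
  imports "Graph_Theory.Graph_Theory"
begin

text \<open>
  A finite simple undirected graph is a \<open>pair_graph\<close>: an edge between \<open>u\<close> and \<open>v\<close> is
  represented by the two arcs \<open>(u, v)\<close> and \<open>(v, u)\<close>, so neighbours are out-neighbours.
\<close>

definition neighbors :: "('a, 'b) pre_digraph \<Rightarrow> 'a \<Rightarrow> 'a set" where
  "neighbors G v = {u. v \<rightarrow>\<^bsub>G\<^esub> u}"

definition leaves :: "('a, 'b) pre_digraph \<Rightarrow> 'a set" where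
  "leaves G = {v \<in> verts G. card (neighbors G v) = 1}"

definition supports :: "('a, 'b) pre_digraph \<Rightarrow> 'a set" where
  "supports G = {v \<in> verts G. neighbors G v \<inter> leaves G \<noteq> {}}"

definition dominating_set :: "('a, 'b) pre_digraph \<Rightarrow> 'a set \<Rightarrow> bool" where
  "dominating_set G D \<longleftrightarrow>
     D \<subseteq> verts G \<and> (\<forall>v \<in> verts G - D. neighbors G v \<inter> D \<noteq> {})"

definition domination_number :: "('a, 'b) pre_digraph \<Rightarrow> nat" where
  "domination_number G = (LEAST n. \<exists>D. dominating_set G D \<and> card D = n)"

definition gamma_minus_critical :: "('a, 'b) pre_digraph \<Rightarrow> 'a \<Rightarrow> bool" where
  "gamma_minus_critical G v \<longleftrightarrow>
     v \<in> verts G \<and> domination_number (pre_digraph.del_vert G v) < domination_number G"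

text \<open>
  The predicate \<open>tree\<close> of \<open>Digraph_Component\<close> excludes directed cycles of every length and so
  fails for every symmetric digraph with an arc: \<open>u, v, u\<close> is a directed cycle of length two.
  The cycles of an undirected simple graph are the directed cycles of length at least three.
\<close>

definition undirected_tree :: "'a pair_pre_digraph \<Rightarrow> bool" where
  "undirected_tree T \<longleftrightarrow>
     pair_graph T \<and> connected T \<and> \<not> (\<exists>p. pre_digraph.cycle T p \<and> 3 \<le> length p)"

definition bipartition :: "('a, 'b) pre_digraph \<Rightarrow> 'a set \<Rightarrow> 'a set \<Rightarrow> bool" where
  "bipartition G A B \<longleftrightarrow>
     A \<union> B = verts G \<and> A \<inter> B = {} \<and> (\<forall>u v. u \<rightarrow>\<^bsub>G\<^esub> v \<longrightarrow> (u \<in> A \<longleftrightarrow> v \<in> B))"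

text \<open>The bipartition of a tree is unique up to the order of its two parts.\<close>

definition T_max :: "'a pair_pre_digraph set" where
  "T_max = {T :: 'a pair_pre_digraph. undirected_tree T \<and>
     (\<exists>A B. bipartition T A B \<and> domination_number T = min (card A) (card B))}"

definition add_pendant :: "'a pair_pre_digraph \<Rightarrow> 'a \<Rightarrow> 'a \<Rightarrow> 'a pair_pre_digraph" where
  "add_pendant G u v =
     \<lparr> pverts = insert v (pverts G), parcs = {(u, v), (v, u)} \<union> parcs G \<rparr>"

text \<open>
  \<open>constructible T A B\<close>: the tree \<open>T\<close> with ordered bipartition \<open>(A, B)\<close> is the last member of
  a sequence that starts with \<open>K\<^sub>2\<close> and applies the four operations.
\<close>

inductive constructible :: "'a pair_pre_digraph \<Rightarrow> 'a set \<Rightarrow> 'a set \<Rightarrow> bool" where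
  K2: "a \<noteq> b \<Longrightarrow>
    constructible \<lparr> pverts = {a, b}, parcs = {(a, b), (b, a)} \<rparr> {a} {b}"
| O1: "\<lbrakk> constructible T A B; b \<notin> pverts T; a' \<in> A \<rbrakk> \<Longrightarrow>
    constructible (add_pendant T a' b) A (insert b B)"
| O2: "\<lbrakk> constructible T A B; a \<notin> pverts T; b' \<in> B;
         neighbors T b' \<subseteq> supports T; b' \<notin> leaves T \<rbrakk> \<Longrightarrow>
    constructible (add_pendant T b' a) (insert a A) B"
| O3: "\<lbrakk> constructible T A B; a \<notin> pverts T; b \<notin> pverts T; a \<noteq> b; a' \<in> A; a' \<in> supports T \<rbrakk> \<Longrightarrow>
    constructible (add_pendant (add_pendant T a' b) b a) (insert a A) (insert b B)"
| O4: "\<lbrakk> constructible T A B; a \<notin> pverts T; b \<notin> pverts T; a \<noteq> b; b' \<in> B;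
         \<not> gamma_minus_critical T b' \<rbrakk> \<Longrightarrow>
    constructible (add_pendant (add_pendant T b' a) a b) (insert a A) (insert b B)"

text \<open>
  The family is closed under isomorphism; the construction itself takes place on vertices from
  the infinite supply \<open>nat\<close>.
\<close>

definition T_family :: "'a pair_pre_digraph set" where
  "T_family = {T :: 'a pair_pre_digraph.
     \<exists>(H :: nat pair_pre_digraph) A B. constructible H A B \<and> digraph_iso T H}"

end

theory Submission
  imports Defs
begin

text \<open>
  Both directions revolve around the equation \<open>\<gamma>(T) = |A|\<close> for the ordered bipartition \<open>(A, B)\<close>.
  Since \<open>A\<close> and \<open>B\<close> are dominating sets, only \<open>\<gamma>(T) \<ge> |A|\<close> matters. Each operation preserves
  it: a dominating set of the new tree may be assumed to contain the relevant support vertices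
  instead of their leaves, and then restricts to one of the old tree.

  Conversely, a tree with a non-leaf has two leaves at the same vertex or a pendant path
  \<open>v0, v1, v2\<close> with \<open>v1\<close> of degree two and \<open>v2\<close> not a leaf. Twin leaves at \<open>v\<close> force \<open>v \<in> A\<close>
  (otherwise exchanging them for \<open>v\<close> in \<open>A\<close> gives a smaller dominating set), so \<open>\<O>\<^sub>1\<close> is undone by
  deleting one. A pendant path with \<open>v1 \<in> A\<close> is always undone by \<open>\<O>\<^sub>4\<close>. If \<open>v1 \<in> B\<close>, then \<open>v2\<close> is a
  support vertex, as otherwise \<open>v1\<close> could replace \<open>v0\<close> and \<open>v2\<close> in \<open>A\<close>, and \<open>\<O>\<^sub>3\<close> is undone. The
  operation \<open>\<O>\<^sub>2\<close> is never needed.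
\<close>

section \<open>Domination in pair graphs\<close>

lemma neighbors_with_proj [simp]: "neighbors (with_proj T) v = {u. (v, u) \<in> parcs T}"
  by (simp add: neighbors_def)

lemma leaves_iff: "v \<in> leaves (with_proj T) \<longleftrightarrow>
    v \<in> pverts T \<and> (\<exists>u. {w. (v, w) \<in> parcs T} = {u})"
  by (simp add: leaves_def card_1_singleton_iff)

lemma leaves_neighbors:
  assumes "l \<in> leaves (with_proj T)" "(l, s) \<in> parcs T"
  shows "{w. (l, w) \<in> parcs T} = {s}"
proof -
  obtain u where "{w. (l, w) \<in> parcs T} = {u}" using assms(1) by (auto simp: leaves_iff)
  moreover have "s \<in> {w. (l, w) \<in> parcs T}" using assms(2) by simp
  ultimately show ?thesis by simp
qed

lemma dominating_set_iff: "dominating_set (with_proj T) D \<longleftrightarrow>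
    D \<subseteq> pverts T \<and> (\<forall>v \<in> pverts T - D. \<exists>u \<in> D. (v, u) \<in> parcs T)"
  by (auto simp: dominating_set_def)

text \<open>Neither \<open>D\<close> nor the vertices to be dominated contain \<open>x\<close>, so
  arcs of \<open>T\<close> can stand in for arcs of the deleted graph.\<close>

lemma dominating_set_del_vert_iff:
  "dominating_set (pre_digraph.del_vert (with_proj T) x) D \<longleftrightarrow>
    D \<subseteq> pverts T - {x} \<and> (\<forall>v \<in> pverts T - {x} - D. \<exists>u \<in> D. (v, u) \<in> parcs T)"
proof -
  have "arcs_ends (pre_digraph.del_vert (with_proj T) x) =
      {(u, v) \<in> parcs T. u \<noteq> x \<and> v \<noteq> x}"
    by (auto simp: arcs_ends_def arc_to_ends_def pre_digraph.del_vert_simps)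
  then show ?thesis
    by (fastforce simp: dominating_set_def neighbors_def pre_digraph.del_vert_simps)
qed

lemma domination_number_le: "dominating_set G D \<Longrightarrow> domination_number G \<le> card D"
  unfolding domination_number_def by (rule Least_le) blast

lemma domination_number_attained:
  obtains D where "dominating_set G D" "card D = domination_number G"
proof -
  have "\<exists>n D. dominating_set G D \<and> card D = n"
    by (auto simp: dominating_set_def intro!: exI[of _ "verts G"])
  then have "\<exists>D. dominating_set G D \<and> card D = domination_number G"
    unfolding domination_number_def by (rule LeastI_ex)
  then show ?thesis using that by blast
qed

lemma domination_number_geI:
  assumes "\<And>D. dominating_set G D \<Longrightarrow> n \<le> card D"
  shows "n \<le> domination_number G"
  using assms domination_number_attained[of G] by metis

text \<open>The vertex \<open>l\<close> dominates at most itself and \<open>s\<close>, and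
  \<open>s\<close> dominates both. If \<open>l\<close> is in \<open>D\<close>, this is a swap; if
  not, \<open>l\<close> is dominated by its only neighbour, so \<open>s\<close> is already in
  \<open>D\<close>.\<close>

lemma leaf_exchange:
  assumes fin: "finite (pverts T)" and sym: "sym (parcs T)" and D: "dominating_set (with_proj T) D"
    and l: "l \<in> pverts T" "{w. (l, w) \<in> parcs T} = {s}" and s: "s \<in> pverts T" "s \<noteq> l"
  shows "dominating_set (with_proj T) (insert s (D - {l}))" "card (insert s (D - {l})) \<le> card D"
proof -
  have nb: "(l, w) \<in> parcs T \<longleftrightarrow> w = s" for w using l(2) by auto
  have finD: "finite D" using D fin by (auto simp: dominating_set_iff intro: finite_subset)
  show "dominating_set (with_proj T) (insert s (D - {l}))"
    unfolding dominating_set_iff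
  proof (intro conjI ballI)
    show "insert s (D - {l}) \<subseteq> pverts T" using D s by (auto simp: dominating_set_iff)
    fix v assume v: "v \<in> pverts T - insert s (D - {l})"
    show "\<exists>u\<in>insert s (D - {l}). (v, u) \<in> parcs T"
    proof (cases "v = l")
      case True then show ?thesis using nb by auto
    next
      case False
      then obtain u where "u \<in> D" "(v, u) \<in> parcs T" using D v by (auto simp: dominating_set_iff)
      moreover have "u \<noteq> l" using calculation(2) nb symD[OF sym] v by blast
      ultimately show ?thesis by auto
    qed
  qed
  show "card (insert s (D - {l})) \<le> card D"
  proof (cases "l \<in> D")
    case True
    have "card (insert s (D - {l})) \<le> Suc (card (D - {l}))" by (rule card_insert_le_m1) auto
    also have "\<dots> = card D" using True finD by (simp only: card_Suc_Diff1)
    finally show ?thesis .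
  next
    case False
    then have "\<exists>u \<in> D. (l, u) \<in> parcs T" using D l(1) by (simp add: dominating_set_iff)
    then have "s \<in> D" using nb by simp
    then show ?thesis using False by (simp add: insert_absorb)
  qed
qed

text \<open>The leaves are exchanged for their supports one at a time. Since each chosen leaf lies
  outside \<open>S\<close>, no exchange removes a support inserted earlier.\<close>

lemma dominating_set_supports:
  assumes fin: "finite (pverts T)" and sym: "sym (parcs T)" and D: "dominating_set (with_proj T) D"
    and "S \<subseteq> pverts T"
    and leaf: "\<And>s. s \<in> S \<Longrightarrow> \<exists>l \<in> pverts T - S. {w. (l, w) \<in> parcs T} = {s}"
  obtains D' where "dominating_set (with_proj T) D'" "S \<subseteq> D'" "card D' \<le> card D"
proof -
  have "finite S" using fin assms(4) by (rule finite_subset[rotated])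
  have "F \<subseteq> S \<Longrightarrow> \<exists>D'. dominating_set (with_proj T) D' \<and> F \<subseteq> D' \<and> card D' \<le> card D"
    if "finite F" for F
    using that
  proof (induction F rule: finite_induct)
    case empty then show ?case using D by auto
  next
    case (insert s F)
    then obtain D' where D': "dominating_set (with_proj T) D'" "F \<subseteq> D'" "card D' \<le> card D" by auto
    obtain l where l: "l \<in> pverts T - S" "{w. (l, w) \<in> parcs T} = {s}"
      using leaf[of s] insert.prems by blast
    have "s \<in> pverts T" "s \<noteq> l" using insert.prems l assms(4) by auto
    with leaf_exchange[OF fin sym D'(1) _ l(2)] l(1) D' insert.prems show ?case
      by (intro exI[of _ "insert s (D' - {l})"]) (auto intro: le_trans)
  qed
  from this[OF \<open>finite S\<close>] that show ?thesis by blast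
qed

section \<open>Bipartite graphs without isolated vertices\<close>

text \<open>The absence of isolated vertices is what makes each part a dominating set. Arcs crossing
  between disjoint parts also exclude loops.\<close>

definition bigraph :: "'a pair_pre_digraph \<Rightarrow> 'a set \<Rightarrow> 'a set \<Rightarrow> bool" where
  "bigraph T A B \<longleftrightarrow> finite (pverts T) \<and> A \<union> B = pverts T \<and> A \<inter> B = {} \<and>
     parcs T \<subseteq> A \<times> B \<union> B \<times> A \<and> sym (parcs T) \<and> (\<forall>v \<in> pverts T. \<exists>u. (v, u) \<in> parcs T)"

lemma bigraphD:
  assumes "bigraph T A B"
  shows "finite (pverts T)" "A \<union> B = pverts T" "A \<inter> B = {}" "sym (parcs T)"
    "\<And>u v. (u, v) \<in> parcs T \<Longrightarrow> u \<in> A \<longleftrightarrow> v \<in> B"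
    "\<And>u v. (u, v) \<in> parcs T \<Longrightarrow> u \<in> B \<longleftrightarrow> v \<in> A"
    "\<And>u v. (u, v) \<in> parcs T \<Longrightarrow> u \<in> pverts T \<and> v \<in> pverts T \<and> u \<noteq> v"
    "\<And>u v. (u, v) \<in> parcs T \<Longrightarrow> (v, u) \<in> parcs T"
    "\<And>v. v \<in> pverts T \<Longrightarrow> \<exists>u. (v, u) \<in> parcs T"
    "finite A" "finite B"
proof -
  have *: "finite (pverts T)" "A \<union> B = pverts T" "A \<inter> B = {}" "sym (parcs T)"
    "parcs T \<subseteq> A \<times> B \<union> B \<times> A" "\<forall>v \<in> pverts T. \<exists>u. (v, u) \<in> parcs T"
    using assms by (simp_all add: bigraph_def)
  from *(1-4) show "finite (pverts T)" "A \<union> B = pverts T" "A \<inter> B = {}" "sym (parcs T)" .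
  show "finite A" "finite B" using *(1) unfolding *(2)[symmetric] by simp_all
  show "\<exists>u. (v, u) \<in> parcs T" if "v \<in> pverts T" for v using *(6) that by blast
  fix u v assume uv: "(u, v) \<in> parcs T"
  then have "u \<in> A \<and> v \<in> B \<or> u \<in> B \<and> v \<in> A" using *(5) by blast
  with *(3) show "u \<in> A \<longleftrightarrow> v \<in> B" "u \<in> B \<longleftrightarrow> v \<in> A" "u \<in> pverts T \<and> v \<in> pverts T \<and> u \<noteq> v"
    unfolding *(2)[symmetric] by blast+
  show "(v, u) \<in> parcs T" using *(4) uv by (rule symD)
qed

text \<open>A vertex outside \<open>A\<close> has a neighbour, which must lie in \<open>A\<close>,
  so \<open>A\<close> dominates. Applied to the swapped parts, this also bounds the domination
  number by \<open>card B\<close>.\<close>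

lemma bigraph_domination_number_le:
  assumes "bigraph T A B" shows "domination_number (with_proj T) \<le> card A"
proof (rule domination_number_le)
  note b = bigraphD[OF assms]
  show "dominating_set (with_proj T) A"
    unfolding dominating_set_iff using b(2,6,9) by blast
qed

section \<open>Attaching pendant vertices, and soundness of the four operations\<close>

lemma add_pendant_simps [simp]:
  "pverts (add_pendant G u v) = insert v (pverts G)"
  "parcs (add_pendant G u v) = {(u, v), (v, u)} \<union> parcs G"
  by (simp_all add: add_pendant_def)

lemma bigraph_swap: "bigraph T A B \<Longrightarrow> bigraph T B A"
  by (simp add: bigraph_def Un_commute Int_commute)

lemma bigraph_add_pendant1:
  assumes b: "bigraph T A B" and x: "x \<notin> pverts T" and u: "u \<in> A"
  shows "bigraph (add_pendant T u x) A (insert x B)"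
proof -
  note t = bigraphD[OF b]
  have "A \<union> insert x B = pverts (add_pendant T u x)" "A \<inter> insert x B = {}"
    using t(2,3) x by auto
  moreover have "parcs (add_pendant T u x) \<subseteq> A \<times> insert x B \<union> insert x B \<times> A"
    using b u by (auto simp: bigraph_def)
  moreover have "sym (parcs (add_pendant T u x))" using t(8) by (auto simp: sym_def)
  moreover have "\<exists>w. (v, w) \<in> parcs (add_pendant T u x)" if "v \<in> pverts (add_pendant T u x)" for v
    using t(9)[of v] that by (cases "v = x") auto
  ultimately show ?thesis using t(1) unfolding bigraph_def by simp
qed

lemma bigraph_add_pendant2:
  assumes "bigraph T A B" "x \<notin> pverts T" "u \<in> B"
  shows "bigraph (add_pendant T u x) (insert x A) B"
  by (rule bigraph_swap[OF bigraph_add_pendant1[OF bigraph_swap[OF assms(1)] assms(2,3)]])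

text \<open>The invariant fixes \<open>card A\<close> rather than the minimum of both parts, because
  the operations treat the parts asymmetrically. In each case a dominating set of the new tree is
  cut down by at least as many vertices as \<open>A\<close> has gained.\<close>

lemma constructible_sound:
  assumes "constructible T A B"
  shows "bigraph T A B \<and> domination_number (with_proj T) = card A"
  using assms
proof (induction rule: constructible.induct)
  case (K2 a b)
  let ?T = "\<lparr>pverts = {a, b}, parcs = {(a, b), (b, a)}\<rparr>"
  have big: "bigraph ?T {a} {b}" using K2 by (auto simp: bigraph_def sym_def)
  have "1 \<le> domination_number (with_proj ?T)"
  proof (rule domination_number_geI)
    fix D assume D: "dominating_set (with_proj ?T) D"
    then have "finite D" "D \<noteq> {}" by (auto simp: dominating_set_iff intro: finite_subset)
    then show "1 \<le> card D" by (simp add: Suc_leI card_gt_0_iff)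
  qed
  with bigraph_domination_number_le[OF big] big show ?case by simp
next
  case (O1 T A B b a')
  then have T: "bigraph T A B" and dn: "domination_number (with_proj T) = card A" by auto
  note t = bigraphD[OF T]
  let ?T = "add_pendant T a' b"
  have big: "bigraph ?T A (insert b B)" using bigraph_add_pendant1[OF T] O1 by simp
  note g = bigraphD[OF big]
  have "card A \<le> domination_number (with_proj ?T)"
  proof (rule domination_number_geI)
    fix D assume D: "dominating_set (with_proj ?T) D"
    have a': "a' \<in> pverts T" using O1 t by auto
    have S: "{a'} \<subseteq> pverts ?T" using a' by auto
    have leaf: "\<exists>l \<in> pverts ?T - {a'}. {w. (l, w) \<in> parcs ?T} = {s}" if "s \<in> {a'}" for s
      using that a' O1.hyps t(7) by (intro bexI[of _ b]) auto
    obtain D' where D': "dominating_set (with_proj ?T) D'" "{a'} \<subseteq> D'" "card D' \<le> card D"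
      using dominating_set_supports[OF g(1,4) D S leaf] by blast
    have finD: "finite D'" using D' g(1) by (auto simp: dominating_set_iff intro: finite_subset)
    \<comment> \<open>Within \<open>T\<close>, the vertex \<open>b\<close> can dominate only
      \<open>a'\<close>, which already lies in \<open>D'\<close>.\<close>
    have "dominating_set (with_proj T) (D' - {b})"
      using D' O1.hyps t(7) by (fastforce simp: dominating_set_iff)
    from domination_number_le[OF this] show "card A \<le> card D"
      using D'(3) card_Diff1_le[of D' b] dn by linarith
  qed
  with bigraph_domination_number_le[OF big] big show ?case by simp
next
  case (O2 T A B a b')
  then have T: "bigraph T A B" and dn: "domination_number (with_proj T) = card A" by auto
  note t = bigraphD[OF T]
  let ?T = "add_pendant T b' a"
  have big: "bigraph ?T (insert a A) B" using bigraph_add_pendant2[OF T] O2 by simp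
  note g = bigraphD[OF big]
  have b': "b' \<in> pverts T" using O2 t by auto
  have aA: "a \<notin> A" using O2 t by auto
  have "card (insert a A) \<le> domination_number (with_proj ?T)"
  proof (rule domination_number_geI)
    fix D assume D: "dominating_set (with_proj ?T) D"
    let ?S = "insert b' {w. (b', w) \<in> parcs T}"
    have S: "?S \<subseteq> pverts ?T" using b' t(7) by auto
    have leaf: "\<exists>l \<in> pverts ?T - ?S. {w. (l, w) \<in> parcs ?T} = {s}" if s: "s \<in> ?S" for s
    proof (cases "s = b'")
      case True
      then show ?thesis using O2.hyps t(7) b' by (intro bexI[of _ a]) auto
    next
      case False
      then have sb: "(b', s) \<in> parcs T" using s by auto
      then have "s \<in> supports (with_proj T)" using O2.hyps by auto
      then obtain l where "(s, l) \<in> parcs T" and ll: "l \<in> leaves (with_proj T)"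
        by (auto simp: supports_def)
      then have lw: "{w. (l, w) \<in> parcs T} = {s}" using t(8) leaves_neighbors by metis
      \<comment> \<open>The leaf \<open>l\<close> must stay outside \<open>?S\<close>. It differs
        from \<open>b'\<close>, which is not a leaf, and it is not adjacent to \<open>b'\<close>,
        because its only neighbour is \<open>s\<close>.\<close>
      have lb: "l \<noteq> b'" using ll O2.hyps by auto
      have "l \<in> pverts T" using ll by (simp add: leaves_iff)
      moreover have "l \<noteq> a" using calculation O2.hyps by auto
      moreover have "(b', l) \<notin> parcs T" using t(8)[of b' l] lw False by auto
      ultimately show ?thesis using lw lb by (intro bexI[of _ l]) auto
    qed
    obtain D' where D': "dominating_set (with_proj ?T) D'" "?S \<subseteq> D'" "card D' \<le> card D"
      using dominating_set_supports[OF g(1,4) D S leaf] by blast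
    have finD: "finite D'" using D' g(1) by (auto simp: dominating_set_iff intro: finite_subset)
    have "dominating_set (with_proj T) (D' - {a, b'})"
      unfolding dominating_set_iff
    proof (intro conjI ballI)
      show "D' - {a, b'} \<subseteq> pverts T" using D' by (auto simp: dominating_set_iff)
      fix v assume v: "v \<in> pverts T - (D' - {a, b'})"
      show "\<exists>u\<in>D' - {a, b'}. (v, u) \<in> parcs T"
      proof (cases "v = b'")
        case True
        then show ?thesis using t(7,9)[of b'] b' D' O2.hyps by fastforce
      next
        case False
        then have vD: "v \<notin> D'" "v \<noteq> a" using v O2.hyps by auto
        then obtain u where u: "u \<in> D'" "(v, u) \<in> parcs T"
          using D' v False by (fastforce simp: dominating_set_iff)
        moreover have "u \<noteq> b'" using u vD D'(2) t(8)[of v u] by auto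
        moreover have "u \<noteq> a" using u(2) t(7) O2.hyps by blast
        ultimately show ?thesis by auto
      qed
    qed
    from domination_number_le[OF this]
    have "card A \<le> card (D' - {a, b'})" using dn by simp
    \<comment> \<open>Whether \<open>a\<close> lies in \<open>D'\<close> is unknown;
      \<open>b'\<close> does lie there, and its removal pays for the new element of
      \<open>A\<close>.\<close>
    also have "\<dots> \<le> card (D' - {b'})" using finD by (intro card_mono) auto
    also have "Suc \<dots> = card D'" using D'(2) finD by (intro card_Suc_Diff1) auto
    finally show "card (insert a A) \<le> card D" using D'(3) aA t(10) by simp
  qed
  with bigraph_domination_number_le[OF big] big show ?case by simp
next
  case (O3 T A B a b a')
  then have T: "bigraph T A B" and dn: "domination_number (with_proj T) = card A" by auto
  note t = bigraphD[OF T]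
  let ?T = "add_pendant (add_pendant T a' b) b a"
  have "bigraph (add_pendant T a' b) A (insert b B)"
    using bigraph_add_pendant1[OF T] O3 by simp
  then have big: "bigraph ?T (insert a A) (insert b B)"
    using O3.hyps by (intro bigraph_add_pendant2) auto
  note g = bigraphD[OF big]
  have a': "a' \<in> pverts T" using O3 t by auto
  have aA: "a \<notin> A" using O3 t by auto
  have "card (insert a A) \<le> domination_number (with_proj ?T)"
  proof (rule domination_number_geI)
    fix D assume D: "dominating_set (with_proj ?T) D"
    obtain l where l: "(a', l) \<in> parcs T" "l \<in> leaves (with_proj T)"
      using O3.hyps by (auto simp: supports_def)
    then have lw: "{w. (l, w) \<in> parcs T} = {a'}" using t(8) leaves_neighbors by metis
    have la: "l \<noteq> a'" "l \<in> pverts T" using t(7)[OF l(1)] by auto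
    have S: "{a', b} \<subseteq> pverts ?T" using a' by auto
    \<comment> \<open>The new leaf \<open>a\<close> serves \<open>b\<close>; the old leaf
      \<open>l\<close> still serves \<open>a'\<close>, since the new edges do not touch
      \<open>l\<close>.\<close>
    have leaf: "\<exists>l \<in> pverts ?T - {a', b}. {w. (l, w) \<in> parcs ?T} = {s}" if "s \<in> {a', b}" for s
    proof (cases "s = b")
      case True
      then show ?thesis using O3.hyps t(7) a' by (intro bexI[of _ a]) auto
    next
      case False
      then show ?thesis using O3.hyps la lw that by (intro bexI[of _ l]) auto
    qed
    obtain D' where D': "dominating_set (with_proj ?T) D'" "{a', b} \<subseteq> D'" "card D' \<le> card D"
      using dominating_set_supports[OF g(1,4) D S leaf] by blast
    have finD: "finite D'" using D' g(1) by (auto simp: dominating_set_iff intro: finite_subset)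
    have "dominating_set (with_proj T) (D' - {a, b})"
      unfolding dominating_set_iff
    proof (intro conjI ballI)
      show "D' - {a, b} \<subseteq> pverts T" using D' by (auto simp: dominating_set_iff)
      fix v assume v: "v \<in> pverts T - (D' - {a, b})"
      then have v': "v \<notin> D'" "v \<noteq> a" "v \<noteq> b" "v \<noteq> a'" "v \<in> pverts T" using O3.hyps D'(2) by auto
      then obtain u where u: "u \<in> D'" "(v, u) \<in> parcs T"
        using D' by (fastforce simp: dominating_set_iff)
      then show "\<exists>u\<in>D' - {a, b}. (v, u) \<in> parcs T" using t(7)[OF u(2)] O3.hyps by auto
    qed
    from domination_number_le[OF this]
    have "card A \<le> card (D' - {a, b})" using dn by simp
    also have "\<dots> \<le> card (D' - {b})" using finD by (intro card_mono) auto
    also have "Suc \<dots> = card D'" using D'(2) finD by (intro card_Suc_Diff1) auto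
    finally show "card (insert a A) \<le> card D" using D'(3) aA t(10) by simp
  qed
  with bigraph_domination_number_le[OF big] big show ?case by simp
next
  case (O4 T A B a b b')
  then have T: "bigraph T A B" and dn: "domination_number (with_proj T) = card A" by auto
  note t = bigraphD[OF T]
  let ?T = "add_pendant (add_pendant T b' a) a b"
  have "bigraph (add_pendant T b' a) (insert a A) B"
    using bigraph_add_pendant2[OF T] O4 by simp
  then have big: "bigraph ?T (insert a A) (insert b B)"
    using O4.hyps by (intro bigraph_add_pendant1) auto
  note g = bigraphD[OF big]
  have b': "b' \<in> pverts T" using O4 t by auto
  have aA: "a \<notin> A" using O4 t by auto
  have "card (insert a A) \<le> domination_number (with_proj ?T)"
  proof (rule domination_number_geI)
    fix D assume D: "dominating_set (with_proj ?T) D"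
    have S: "{a} \<subseteq> pverts ?T" by auto
    have leaf: "\<exists>l \<in> pverts ?T - {a}. {w. (l, w) \<in> parcs ?T} = {s}" if "s \<in> {a}" for s
      using that b' O4.hyps t(7) by (intro bexI[of _ b]) auto
    obtain D' where D': "dominating_set (with_proj ?T) D'" "{a} \<subseteq> D'" "card D' \<le> card D"
      using dominating_set_supports[OF g(1,4) D S leaf] by blast
    have finD: "finite D'" using D' g(1) by (auto simp: dominating_set_iff intro: finite_subset)
    let ?D = "D' - {a, b}"
    have sub: "?D \<subseteq> pverts T" using D' by (auto simp: dominating_set_iff)
    \<comment> \<open>Among the vertices of \<open>T\<close>, only \<open>b'\<close> can have been
      dominated by a new vertex, namely by \<open>a\<close>.\<close>
    have dom: "\<exists>u\<in>?D. (v, u) \<in> parcs T" if v: "v \<in> pverts T - ?D" "v \<noteq> b'" for v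
    proof -
      have v': "v \<notin> D'" "v \<noteq> a" "v \<noteq> b" using v O4.hyps by auto
      then obtain u where u: "u \<in> D'" "(v, u) \<in> parcs T"
        using D' v by (fastforce simp: dominating_set_iff)
      then show ?thesis using t(7)[OF u(2)] O4.hyps by auto
    qed
    have "card A \<le> card ?D"
    proof (cases "dominating_set (with_proj T) ?D")
      case True
      then show ?thesis using domination_number_le dn by metis
    next
      case False
      then have "b' \<notin> ?D" using dom sub unfolding dominating_set_iff by blast
      \<comment> \<open>If \<open>?D\<close> fails to dominate \<open>T\<close>, it misses exactly
        \<open>b'\<close> and so dominates \<open>T - b'\<close>. As \<open>b'\<close> is not
        critical, that also takes at least \<open>card A\<close> vertices.\<close>
      then have "dominating_set (pre_digraph.del_vert (with_proj T) b') ?D"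
        using sub dom unfolding dominating_set_del_vert_iff by auto
      from domination_number_le[OF this] show ?thesis
        using O4.hyps b' dn by (simp add: gamma_minus_critical_def)
    qed
    also have "\<dots> \<le> card (D' - {a})" using finD by (intro card_mono) auto
    also have "Suc \<dots> = card D'" using D'(2) finD by (intro card_Suc_Diff1) auto
    finally show "card (insert a A) \<le> card D" using D'(3) aA t(10) by simp
  qed
  with bigraph_domination_number_le[OF big] big show ?case by simp
qed

section \<open>Connectedness and acyclicity by vertex sets\<close>

text \<open>Unlike walks and cycles, these two properties pass to vertex-deleted subgraphs and along
  isomorphisms by manipulating vertex sets only.\<close>

definition set_connected :: "'a pair_pre_digraph \<Rightarrow> bool" where
  "set_connected T \<longleftrightarrow> (\<forall>U \<subseteq> pverts T. U \<noteq> {} \<longrightarrow>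
     (\<forall>u \<in> U. \<forall>w. (u, w) \<in> parcs T \<longrightarrow> w \<in> U) \<longrightarrow> U = pverts T)"

definition one_degenerate :: "'a pair_pre_digraph \<Rightarrow> bool" where
  "one_degenerate T \<longleftrightarrow> (\<forall>U \<subseteq> pverts T. U \<noteq> {} \<longrightarrow>
     (\<exists>v \<in> U. card {u \<in> U. (v, u) \<in> parcs T} \<le> 1))"

lemma set_connectedD:
  assumes "set_connected T" "U \<subseteq> pverts T" "U \<noteq> {}"
    "\<And>u w. u \<in> U \<Longrightarrow> (u, w) \<in> parcs T \<Longrightarrow> w \<in> U"
  shows "U = pverts T"
  using assms unfolding set_connected_def by blast

text \<open>A set closed under neighbours contains everything reachable from any of its vertices.
  The arcs are symmetric already, so the symmetric closure in \<open>connected\<close> adds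
  none.\<close>

lemma (in pair_graph) set_connected_if_connected:
  assumes "connected G"
  shows "set_connected G"
  unfolding set_connected_def
proof (intro allI impI)
  fix U assume U: "U \<subseteq> pverts G" "U \<noteq> {}"
    and cl: "\<forall>u\<in>U. \<forall>w. (u, w) \<in> parcs G \<longrightarrow> w \<in> U"
  have par: "parcs (mk_symmetric (with_proj G)) = parcs G"
    using arcs_symmetric by (auto simp: mk_symmetric_def)
  obtain u where u: "u \<in> U" using U by auto
  have "w \<in> U" if "w \<in> pverts G" for w
  proof -
    have "u \<rightarrow>\<^sup>*\<^bsub>with_proj (mk_symmetric (with_proj G))\<^esub> w"
      using assms that u U unfolding connected_def strongly_connected_def
      by (auto simp: mk_symmetric_def)
    then have "(u, w) \<in> rtrancl_on (pverts G) (parcs G)"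
      by (simp add: reachable_def par)
    then show "w \<in> U"
      by (induction rule: rtrancl_on_induct) (use u cl in auto)
  qed
  then show "U = pverts G" using U by auto
qed

text \<open>If all degrees inside \<open>U\<close> are at least two, then the first vertex of a longest path
  inside \<open>U\<close> has a second neighbour, which must lie on the path and closes a cycle.\<close>

lemma (in pair_graph) one_degenerate_if_acyclic:
  assumes acyc: "\<not> (\<exists>p. cycle p \<and> 3 \<le> length p)"
  shows "one_degenerate G"
  unfolding one_degenerate_def
proof (intro allI impI, rule ccontr)
  fix U assume U: "U \<subseteq> pverts G" "U \<noteq> {}"
    and neg: "\<not> (\<exists>v\<in>U. card {u \<in> U. (v, u) \<in> parcs G} \<le> 1)"
  have finU: "finite U" by (rule finite_subset[OF U(1) pair_finite_verts])
  define P where "P p \<longleftrightarrow> (\<exists>x z. apath x p z \<and> set (awalk_verts x p) \<subseteq> U)" for p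
  obtain u0 where "u0 \<in> U" using U by auto
  then have "P []" unfolding P_def apath_def awalk_def using U
    by (intro exI[of _ u0]) auto
  moreover have "length p < Suc (card U)" if "P p" for p
  proof -
    from that obtain x z where xz: "apath x p z" "set (awalk_verts x p) \<subseteq> U" unfolding P_def by auto
    have "Suc (length p) = card (set (awalk_verts x p))"
      using xz(1) length_awalk_verts[of x p] unfolding apath_def by (metis distinct_card)
    also have "\<dots> \<le> card U" using xz finU by (intro card_mono) auto
    finally show ?thesis by simp
  qed
  ultimately obtain p where p: "P p" and max: "\<And>q. P q \<Longrightarrow> length q \<le> length p"
    using ex_has_greatest_nat[of P "[]" length "Suc (card U)"] by blast
  then obtain x z where xz: "apath x p z" "set (awalk_verts x p) \<subseteq> U" unfolding P_def by auto
  then have aw: "awalk x p z" and dist: "distinct (awalk_verts x p)" unfolding apath_def by auto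
  have "x \<in> U" using xz(2) aw by (metis awalkE awalk_verts_non_Nil hd_in_set subsetD)
  then have "\<not> card {u \<in> U. (x, u) \<in> parcs G} \<le> 1" using neg by auto
  \<comment> \<open>With two neighbours in \<open>U\<close>, one differs from the second vertex of
    the path. For empty \<open>p\<close> the value \<open>snd (hd p)\<close> is unspecified, but it
    still excludes only one vertex.\<close>
  then have "\<not> {u \<in> U. (x, u) \<in> parcs G} \<subseteq> {snd (hd p)}"
    using card_mono[of "{snd (hd p)}" "{u \<in> U. (x, u) \<in> parcs G}"] by auto
  then obtain y where y: "y \<in> U" "(x, y) \<in> parcs G" "y \<noteq> snd (hd p)" by auto
  have yx: "(y, x) \<in> parcs G" using y arcs_symmetric by auto
  have "y \<noteq> x" using no_loops' y by auto
  have yp: "y \<in> set (awalk_verts x p)"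
  proof (rule ccontr)
    assume n: "y \<notin> set (awalk_verts x p)"
    have "awalk y ((y, x) # p) z" using aw yx U y by (auto simp: awalk_Cons_iff)
    then have "P ((y, x) # p)" using dist n y xz(2) unfolding P_def apath_def
      by (intro exI[of _ y] exI[of _ z]) auto
    from max[OF this] show False by simp
  qed
  then obtain q r where qr: "p = q @ r" "awalk x q y"
    using awalk_decomp[OF aw] by blast
  have dq: "distinct (awalk_verts x q)"
    using dist awalk_verts_append[of x q r z] aw qr(1) by simp
  have "q \<noteq> []" using qr(2) \<open>y \<noteq> x\<close> by (auto simp: awalk_Nil_iff)
  have "cycle ((y, x) # q)"
    unfolding cycle_def using qr(2) yx dq y U
    by (intro exI[of _ y]) (auto simp: awalk_Cons_iff)
  \<comment> \<open>A single arc \<open>q\<close> would end at the second vertex of the path, which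
    \<open>y\<close> is not. The closing arc then brings the cycle to length at least three.\<close>
  moreover have "2 \<le> length q"
  proof (rule ccontr)
    assume "\<not> 2 \<le> length q"
    then obtain e where "q = [e]" using \<open>q \<noteq> []\<close> by (cases q; cases "tl q") auto
    then have "snd (hd p) = y" using qr by (auto simp: awalk_Cons_iff awalk_Nil_iff)
    then show False using y by simp
  qed
  ultimately show False using acyc by (metis Suc_le_mono length_Cons numeral_3_eq_3 numeral_2_eq_2)
qed

text \<open>An isolated vertex would form a closed set by itself, and \<open>w\<close> lies outside
  it.\<close>

lemma set_connected_no_isolated:
  assumes "set_connected T" "v \<in> pverts T" "w \<in> pverts T" "v \<noteq> w"
  shows "\<exists>u. (v, u) \<in> parcs T"
proof (rule ccontr)
  assume "\<nexists>u. (v, u) \<in> parcs T"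
  then have "{v} = pverts T" using set_connectedD[of T "{v}"] assms by auto
  then show False using assms by auto
qed

section \<open>Deleting vertex sets\<close>

definition remove :: "'a set \<Rightarrow> 'a pair_pre_digraph \<Rightarrow> 'a pair_pre_digraph" where
  "remove X T = \<lparr>pverts = pverts T - X, parcs = {(u, v) \<in> parcs T. u \<notin> X \<and> v \<notin> X}\<rparr>"

lemma remove_simps [simp]:
  "pverts (remove X T) = pverts T - X"
  "(u, v) \<in> parcs (remove X T) \<longleftrightarrow> (u, v) \<in> parcs T \<and> u \<notin> X \<and> v \<notin> X"
  by (auto simp: remove_def)

text \<open>The set \<open>X\<close> is attached to the rest only through \<open>v\<close>. A closed
  set of the remainder that contains \<open>v\<close> becomes closed in \<open>T\<close> when
  \<open>X\<close> is added; one that misses \<open>v\<close> is closed in \<open>T\<close> already,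
  hence would be everything.\<close>

lemma set_connected_remove:
  assumes T: "set_connected T" and b: "bigraph T A B" and v: "v \<in> pverts T - X"
    and X: "\<And>x w. x \<in> X \<Longrightarrow> (x, w) \<in> parcs T \<Longrightarrow> w \<in> insert v X"
  shows "set_connected (remove X T)"
  unfolding set_connected_def
proof (intro allI impI)
  note t = bigraphD[OF b]
  fix U assume U: "U \<subseteq> pverts (remove X T)" "U \<noteq> {}"
    and cl: "\<forall>u\<in>U. \<forall>w. (u, w) \<in> parcs (remove X T) \<longrightarrow> w \<in> U"
  show "U = pverts (remove X T)"
  proof (cases "v \<in> U")
    case True
    have "U \<union> (X \<inter> pverts T) = pverts T"
    proof (rule set_connectedD[OF T])
      fix u w assume u: "u \<in> U \<union> (X \<inter> pverts T)" "(u, w) \<in> parcs T"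
      then show "w \<in> U \<union> (X \<inter> pverts T)"
        using cl X True U t(7)[OF u(2)] by (cases "w \<in> X"; cases "u \<in> X") auto
    qed (use U in auto)
    then show ?thesis using U by auto
  next
    case False
    have "U = pverts T"
    proof (rule set_connectedD[OF T])
      fix u w assume u: "u \<in> U" "(u, w) \<in> parcs T"
      then have "w \<notin> X" using X[of w u] t(8)[OF u(2)] False U by auto
      then show "w \<in> U" using u cl U by auto
    qed (use U in auto)
    then show ?thesis using False v by auto
  qed
qed

lemma one_degenerate_remove:
  assumes "one_degenerate T"
  shows "one_degenerate (remove X T)"
  unfolding one_degenerate_def
proof (intro allI impI)
  fix U assume U: "U \<subseteq> pverts (remove X T)" "U \<noteq> {}"
  then obtain v where v: "v \<in> U" "card {u \<in> U. (v, u) \<in> parcs T} \<le> 1"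
    using assms unfolding one_degenerate_def by (metis Diff_subset remove_simps(1) subset_trans)
  moreover have "{u \<in> U. (v, u) \<in> parcs (remove X T)} = {u \<in> U. (v, u) \<in> parcs T}"
    using U v by auto
  ultimately show "\<exists>v\<in>U. card {u \<in> U. (v, u) \<in> parcs (remove X T)} \<le> 1" by metis
qed

text \<open>The only danger is an isolated vertex in the remainder; connectedness and two distinct
  remaining vertices rule it out.\<close>

lemma bigraph_remove:
  assumes b: "bigraph T A B" and c: "set_connected (remove X T)"
    and xy: "x \<in> pverts T - X" "y \<in> pverts T - X" "x \<noteq> y"
  shows "bigraph (remove X T) (A - X) (B - X)"
proof -
  note t = bigraphD[OF b]
  have "\<exists>u. (v, u) \<in> parcs (remove X T)" if "v \<in> pverts (remove X T)" for v
    using set_connected_no_isolated[OF c that, of x] set_connected_no_isolated[OF c that, of y] xy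
    by (cases "v = x") auto
  moreover have "sym (parcs (remove X T))" using t(8) by (auto simp: sym_def)
  moreover have "parcs (remove X T) \<subseteq> (A - X) \<times> (B - X) \<union> (B - X) \<times> (A - X)"
    using b by (auto simp: bigraph_def)
  moreover have "(A - X) \<union> (B - X) = pverts (remove X T)" "(A - X) \<inter> (B - X) = {}"
    using t(2,3) by auto
  ultimately show ?thesis using t(1) unfolding bigraph_def by simp
qed

section \<open>Decomposing extremal trees\<close>

text \<open>The vertex \<open>v\<close> resp. \<open>v1\<close> is one with at most one neighbour among the non-leaves.\<close>

lemma twin_leaves_or_pendant_path:
  assumes b: "bigraph T A B" and deg: "one_degenerate T"
    and nonleaf: "w \<in> pverts T" "w \<notin> leaves (with_proj T)"
  obtains
    (twins) v x y where "x \<noteq> y" "{w. (x, w) \<in> parcs T} = {v}" "{w. (y, w) \<in> parcs T} = {v}"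
  | (path) v0 v1 v2 where "{w. (v0, w) \<in> parcs T} = {v1}" "{w. (v1, w) \<in> parcs T} = {v0, v2}"
      "v0 \<noteq> v2" "v2 \<notin> leaves (with_proj T)"
proof -
  note t = bigraphD[OF b]
  let ?U = "pverts T - leaves (with_proj T)"
  obtain v where v: "v \<in> ?U" "card {u \<in> ?U. (v, u) \<in> parcs T} \<le> 1"
    using deg nonleaf unfolding one_degenerate_def by (metis DiffI Diff_subset empty_iff)
  let ?N = "{u. (v, u) \<in> parcs T}" and ?L = "{u \<in> leaves (with_proj T). (v, u) \<in> parcs T}"
  have leafN: "{w. (x, w) \<in> parcs T} = {v}" if "x \<in> ?L" for x
    using that t(8)[of v x] by (intro leaves_neighbors) auto
  have finN: "finite ?N" by (rule finite_subset[OF _ t(1)]) (use t(7) in auto)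
  have "?N \<noteq> {}" using t(9) v by auto
  then have "card ?N \<noteq> 0" using finN by simp
  moreover have "card ?N \<noteq> 1" using v by (auto simp: leaves_def)
  moreover have "card ?N = card {u \<in> ?U. (v, u) \<in> parcs T} + card ?L"
  proof -
    have "?N = {u \<in> ?U. (v, u) \<in> parcs T} \<union> ?L" using t(7) by auto
    moreover have "finite {u \<in> ?U. (v, u) \<in> parcs T}" "finite ?L"
      by (rule finite_subset[OF _ finN]; auto)+
    ultimately show ?thesis by (metis (no_types, lifting) card_Un_disjoint disjoint_iff mem_Collect_eq Diff_iff)
  qed
  \<comment> \<open>As a non-leaf, \<open>v\<close> has degree at least two, and at most one of its
    neighbours is a non-leaf. So it has two leaves, or exactly one leaf and one further
    neighbour.\<close>
  ultimately consider "2 \<le> card ?L" | "card ?L = 1" "card {u \<in> ?U. (v, u) \<in> parcs T} = 1"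
    using v(2) by linarith
  then show thesis
  proof cases
    case 1
    then obtain S where S: "S \<subseteq> ?L" "card S = 2" by (rule obtain_subset_with_card_n)
    from S(2) obtain x y where "S = {x, y}" "x \<noteq> y" by (auto simp: card_2_iff)
    then show thesis using twins leafN[of x] leafN[of y] S(1) by simp
  next
    case 2
    then obtain v0 v2 where v02: "?L = {v0}" "{u \<in> ?U. (v, u) \<in> parcs T} = {v2}"
      by (meson card_1_singletonE)
    have "?N = ?L \<union> {u \<in> ?U. (v, u) \<in> parcs T}" using t(7) by auto
    then have "?N = {v0, v2}" using v02 by simp
    moreover have "v2 \<notin> leaves (with_proj T)" "v0 \<in> ?L" using v02 by auto
    moreover have "v0 \<noteq> v2" using calculation(2,3) by auto
    ultimately show thesis using path[OF leafN] by simp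
  qed
qed

lemma add_pendant_remove:
  assumes b: "bigraph T A B" and x: "{w. (x, w) \<in> parcs T} = {v}"
  shows "add_pendant (remove {x} T) v x = T"
proof -
  note t = bigraphD[OF b]
  have xw: "(x, w) \<in> parcs T \<longleftrightarrow> w = v" for w using x by auto
  then have wx: "(w, x) \<in> parcs T \<longleftrightarrow> w = v" for w using t(8) by blast
  have "x \<in> pverts T" using xw t(7) by blast
  then show ?thesis
    using xw wx by (intro pair_pre_digraph.equality set_eqI) (auto simp: split_paired_all)
qed

lemma add_pendant_path_remove:
  assumes b: "bigraph T A B" and x: "{w. (v0, w) \<in> parcs T} = {v1}"
    and y: "{w. (v1, w) \<in> parcs T} = {v0, v2}" and "v0 \<noteq> v2"
  shows "add_pendant (add_pendant (remove {v0, v1} T) v2 v1) v1 v0 = T"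
proof -
  note t = bigraphD[OF b]
  have xw: "(v0, w) \<in> parcs T \<longleftrightarrow> w = v1" "(v1, w) \<in> parcs T \<longleftrightarrow> w = v0 \<or> w = v2" for w using x y by auto
  then have wx: "(w, v0) \<in> parcs T \<longleftrightarrow> w = v1" "(w, v1) \<in> parcs T \<longleftrightarrow> w = v0 \<or> w = v2" for w
    using t(8) by blast+
  have "v0 \<in> pverts T" "v1 \<in> pverts T" using xw t(7) by blast+
  then show ?thesis
    using xw wx by (intro pair_pre_digraph.equality set_eqI) (auto simp: split_paired_all)
qed

text \<open>Strong induction on the number of vertices, with both parts generalized. The equation
  with \<open>card A\<close> fixes the orientation of the bipartition and has to be re-established
  for every remainder.\<close>

lemma constructible_complete:
  assumes "bigraph T A B" "set_connected T" "one_degenerate T" "pverts T \<noteq> {}"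
    "domination_number (with_proj T) = card A"
  shows "constructible T A B"
  using assms
proof (induction "card (pverts T)" arbitrary: T A B rule: less_induct)
  case less
  note t = bigraphD[OF less.prems(1)]
  note conn = less.prems(2)
  have lower: "card A \<le> card D" if "dominating_set (with_proj T) D" for D
    using domination_number_le[OF that] less.prems(5) by simp
  have smaller: "card (pverts (remove X T)) < card (pverts T)" if "x \<in> X" "x \<in> pverts T" for x X
    using that t(1) by (intro psubset_card_mono) auto
  show ?case
  proof (cases "pverts T \<subseteq> leaves (with_proj T)")
    case True
    obtain v where v: "v \<in> A"
      using less.prems(4) t(2,6,9) by blast
    have "v \<in> pverts T" using v t(2) by auto
    then obtain u where vu: "(v, u) \<in> parcs T" using t(9) by blast
    then have u: "{w. (v, w) \<in> parcs T} = {u}"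
      using True \<open>v \<in> pverts T\<close> by (intro leaves_neighbors) auto
    then have uB: "u \<in> B" "u \<in> pverts T" "v \<noteq> u" "(u, v) \<in> parcs T" using t(5,7,8) v by blast+
    then have u': "{w. (u, w) \<in> parcs T} = {v}" using True by (intro leaves_neighbors) auto
    \<comment> \<open>Each of \<open>v\<close> and \<open>u\<close> is the only neighbour of the
      other, so the pair is closed and the tree is \<open>K2\<close>.\<close>
    have V: "{v, u} = pverts T"
      using u u' uB v t(2) by (intro set_connectedD[OF conn]) auto
    have e: "(a, b) \<in> parcs T \<longleftrightarrow> a = v \<and> b = u \<or> a = u \<and> b = v" for a b
    proof -
      have "(v, b) \<in> parcs T \<longleftrightarrow> b = u" "(u, b) \<in> parcs T \<longleftrightarrow> b = v" using u u' by auto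
      moreover have "a = v \<or> a = u" if "(a, b) \<in> parcs T" using t(7)[OF that] V by auto
      ultimately show ?thesis using uB(3) by auto
    qed
    have "parcs T = {(v, u), (u, v)}"
    proof (intro set_eqI)
      fix e show "e \<in> parcs T \<longleftrightarrow> e \<in> {(v, u), (u, v)}"
        using e[of "fst e" "snd e"] by (cases e) auto
    qed
    then have "T = \<lparr>pverts = {v, u}, parcs = {(v, u), (u, v)}\<rparr>" by (simp add: V)
    moreover have "A = {v}" "B = {u}" using V t(2,3) v uB by auto
    ultimately show ?thesis using constructible.K2[OF uB(3)] by simp
  next
    case False
    then obtain w where w: "w \<in> pverts T" "w \<notin> leaves (with_proj T)" by auto
    from less.prems(1,3) w show ?thesis
    proof (cases rule: twin_leaves_or_pendant_path)
      case (twins v x y)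
      have xw: "(x, w) \<in> parcs T \<longleftrightarrow> w = v" "(y, w) \<in> parcs T \<longleftrightarrow> w = v" for w
        using twins by auto
      have V: "x \<in> pverts T" "y \<in> pverts T" "v \<in> pverts T" "v \<noteq> x" "v \<noteq> y"
        using xw t(7) by blast+
      have "v \<in> A"
      proof (rule ccontr)
        assume "v \<notin> A"
        then have vB: "v \<in> B" "x \<in> A" "y \<in> A" using V t(2) t(6)[of x v] t(6)[of y v] t(5) xw by auto
        \<comment> \<open>The twins are adjacent to \<open>v\<close> only, so every other vertex of
          \<open>B\<close> keeps its neighbours in \<open>A\<close>.\<close>
        have "dominating_set (with_proj T) (insert v (A - {x, y}))"
          unfolding dominating_set_iff
        proof (intro conjI ballI)
          show "insert v (A - {x, y}) \<subseteq> pverts T" using V t(2) by auto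
          fix b assume b: "b \<in> pverts T - insert v (A - {x, y})"
          show "\<exists>u\<in>insert v (A - {x, y}). (b, u) \<in> parcs T"
          proof (cases "b = x \<or> b = y")
            case True then show ?thesis using xw by auto
          next
            case False
            then have "b \<in> B" "b \<noteq> v" using b t(2) by auto
            moreover obtain u where u: "(b, u) \<in> parcs T" using b t(9) by blast
            moreover have "u \<noteq> x" "u \<noteq> y" using t(8)[OF u] xw \<open>b \<noteq> v\<close> by auto
            ultimately show ?thesis using t(6) by blast
          qed
        qed
        from lower[OF this] have "card A \<le> card (insert v (A - {x, y}))" .
        also have "\<dots> \<le> Suc (card (A - {x, y}))" by (rule card_insert_le_m1) auto
        also have "card (A - {x, y}) = card A - 2"
          using vB twins(1) t(10) by (subst card_Diff_subset) auto
        finally have "card A \<le> Suc (card A - 2)" .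
        \<comment> \<open>Subtraction is truncated: for \<open>card A\<close> at most one, the
          preceding inequality would be no contradiction.\<close>
        moreover have "2 \<le> card A"
          using card_mono[OF t(10), of "{x, y}"] vB twins(1) by simp
        ultimately show False by linarith
      qed
      then have xB: "x \<in> B" "x \<notin> A" using xw(1)[of v] t(3,5,6) by blast+
      let ?T = "remove {x} T"
      have conn': "set_connected ?T"
        by (rule set_connected_remove[OF conn less.prems(1), of v]) (use V xw in auto)
      have big: "bigraph ?T A (B - {x})"
        using bigraph_remove[OF less.prems(1) conn', of v y] V twins(1) xB by auto
      note g = bigraphD[OF big]
      \<comment> \<open>The other twin \<open>y\<close> keeps \<open>v\<close> a support of the
        remainder. A dominating set may thus be assumed to contain \<open>v\<close>, and then it
        dominates \<open>x\<close> too.\<close>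
      have "card A \<le> domination_number (with_proj ?T)"
      proof (rule domination_number_geI)
        fix D assume D: "dominating_set (with_proj ?T) D"
        have S: "{v} \<subseteq> pverts ?T" using V by auto
        have leaf: "\<exists>l \<in> pverts ?T - {v}. {w. (l, w) \<in> parcs ?T} = {s}" if "s \<in> {v}" for s
          using that V xw twins(1) by (intro bexI[of _ y]) auto
        obtain D' where D': "dominating_set (with_proj ?T) D'" "{v} \<subseteq> D'" "card D' \<le> card D"
          using dominating_set_supports[OF g(1,4) D S leaf] by blast
        have "dominating_set (with_proj T) D'"
          using D'(1,2) xw(1) by (fastforce simp: dominating_set_iff)
        from lower[OF this] show "card A \<le> card D" using D'(3) by simp
      qed
      then have "domination_number (with_proj ?T) = card A"
        using bigraph_domination_number_le[OF big] by simp
      then have "constructible ?T A (B - {x})"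
        using less.hyps[OF smaller[of x "{x}"] big conn' one_degenerate_remove[OF less.prems(3)]] V by auto
      then have "constructible (add_pendant ?T v x) A (insert x (B - {x}))"
        using \<open>v \<in> A\<close> by (intro constructible.O1) auto
      then show ?thesis
        using add_pendant_remove[OF less.prems(1) twins(2)] xB by (simp add: insert_absorb)
    next
      case (path v0 v1 v2)
      have xw: "(v0, w) \<in> parcs T \<longleftrightarrow> w = v1" "(v1, w) \<in> parcs T \<longleftrightarrow> w = v0 \<or> w = v2" for w
        using path by auto
      have wx: "(w, v0) \<in> parcs T \<longleftrightarrow> w = v1" "(w, v1) \<in> parcs T \<longleftrightarrow> w = v0 \<or> w = v2" for w
        using t(8) xw by blast+
      have V: "v0 \<in> pverts T" "v1 \<in> pverts T" "v2 \<in> pverts T" "v0 \<noteq> v1" "v1 \<noteq> v2"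
        using xw t(7) by blast+
      \<comment> \<open>Together with \<open>v2\<close>, this gives two distinct vertices that
        survive the deletion of the path.\<close>
      obtain v3 where v3: "(v2, v3) \<in> parcs T" "v3 \<noteq> v1"
      proof -
        have "{w. (v2, w) \<in> parcs T} \<noteq> {v1}" using path(4) V by (auto simp: leaves_iff)
        then show thesis using that wx(2) by blast
      qed
      have v3': "v3 \<in> pverts T" "v3 \<noteq> v2" "v3 \<noteq> v0" using v3 t(7) wx V by blast+
      let ?T = "remove {v0, v1} T"
      have T: "add_pendant (add_pendant ?T v2 v1) v1 v0 = T"
        by (rule add_pendant_path_remove[OF less.prems(1) path(1,2,3)])
      have conn': "set_connected ?T"
        by (rule set_connected_remove[OF conn less.prems(1), of v2]) (use V xw path(3) in auto)
      have big: "bigraph ?T (A - {v0, v1}) (B - {v0, v1})"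
        using bigraph_remove[OF less.prems(1) conn', of v2 v3] V v3 v3' path(3) by auto
      have cardA: "card A = Suc (card (A - {v0, v1}))"
      proof -
        have "v0 \<in> A \<longleftrightarrow> v1 \<notin> A" using t(2,3) t(5)[of v0 v1] xw V by blast
        then consider "v0 \<in> A" "A - {v0, v1} = A - {v0}" | "v1 \<in> A" "A - {v0, v1} = A - {v1}" by blast
        then show ?thesis using t(10) by cases (simp_all only: card_Suc_Diff1)
      qed
      \<comment> \<open>Adding \<open>v1\<close> takes care of \<open>v0\<close>, \<open>v1\<close>
        and \<open>v2\<close>, so \<open>D\<close> may leave \<open>v2\<close> undominated. The
        claim therefore covers dominating sets of the remainder and also of the remainder without
        \<open>v2\<close>.\<close>
      have extend: "card A \<le> Suc (card D)"
        if "D \<subseteq> pverts ?T" "\<And>v. v \<in> pverts ?T - D \<Longrightarrow> v \<noteq> v2 \<Longrightarrow> \<exists>u \<in> D. (v, u) \<in> parcs T" for D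
      proof -
        have "dominating_set (with_proj T) (insert v1 D)"
          unfolding dominating_set_iff
        proof (intro conjI ballI)
          fix v assume v: "v \<in> pverts T - insert v1 D"
          show "\<exists>u\<in>insert v1 D. (v, u) \<in> parcs T"
            using wx(2) that(2)[of v] v by (cases "v = v0 \<or> v = v2") auto
        qed (use that V in auto)
        from lower[OF this] show ?thesis using card_insert_le_m1[of "Suc (card D)" D v1] by simp
      qed
      have "card (A - {v0, v1}) \<le> domination_number (with_proj ?T)"
      proof (rule domination_number_geI)
        fix D assume D: "dominating_set (with_proj ?T) D"
        then have "card A \<le> Suc (card D)" by (intro extend) (fastforce simp: dominating_set_iff)+
        then show "card (A - {v0, v1}) \<le> card D" using cardA by simp
      qed
      then have dn: "domination_number (with_proj ?T) = card (A - {v0, v1})"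
        using bigraph_domination_number_le[OF big] by simp
      have cons: "constructible ?T (A - {v0, v1}) (B - {v0, v1})"
        using less.hyps[OF smaller[of v0 "{v0, v1}"] big conn' one_degenerate_remove[OF less.prems(3)]] V dn path(3) by auto
      show ?thesis
      proof (cases "v1 \<in> A")
        case True
        then have AB: "v0 \<in> B" "v2 \<in> B" "v0 \<notin> A" "v1 \<notin> B"
          using t(3,5) xw(2) by blast+
        \<comment> \<open>By \<open>extend\<close>, even after deletion of \<open>v2\<close> a
          dominating set has at least \<open>card A - 1\<close> vertices, which is the domination
          number of the remainder.\<close>
        have "\<not> gamma_minus_critical (with_proj ?T) v2"
        proof -
          have "card (A - {v0, v1}) \<le> domination_number (pre_digraph.del_vert (with_proj ?T) v2)"
          proof (rule domination_number_geI)
            fix D assume D: "dominating_set (pre_digraph.del_vert (with_proj ?T) v2) D"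
            then have "card A \<le> Suc (card D)"
              by (intro extend) (fastforce simp: dominating_set_del_vert_iff)+
            then show "card (A - {v0, v1}) \<le> card D" using cardA by simp
          qed
          then show ?thesis using dn by (simp add: gamma_minus_critical_def)
        qed
        then have "constructible (add_pendant (add_pendant ?T v2 v1) v1 v0)
            (insert v1 (A - {v0, v1})) (insert v0 (B - {v0, v1}))"
          using AB V path(3) by (intro constructible.O4[OF cons]) auto
        moreover have "insert v1 (A - {v0, v1}) = A" "insert v0 (B - {v0, v1}) = B"
          using True AB by auto
        ultimately show ?thesis using T by simp
      next
        case False
        then have AB: "v0 \<in> A" "v2 \<in> A" "v0 \<notin> B" "v1 \<in> B"
          using t(2,3,6) xw(2) V by blast+
        have "v2 \<in> supports (with_proj T)"
        proof (rule ccontr)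
          assume ns: "v2 \<notin> supports (with_proj T)"
          have "dominating_set (with_proj T) (insert v1 (A - {v0, v2}))"
            unfolding dominating_set_iff
          proof (intro conjI ballI)
            show "insert v1 (A - {v0, v2}) \<subseteq> pverts T" using V t(2) by auto
            fix b assume b: "b \<in> pverts T - insert v1 (A - {v0, v2})"
            show "\<exists>u\<in>insert v1 (A - {v0, v2}). (b, u) \<in> parcs T"
            proof (cases "b = v0 \<or> b = v2")
              case True then show ?thesis using wx by auto
            next
              case False
              then have bB: "b \<in> B" "b \<noteq> v1" using b t(2) by auto
              \<comment> \<open>Otherwise \<open>b\<close> would be a leaf at \<open>v2\<close>,
                making \<open>v2\<close> a support. The neighbour found is not \<open>v0\<close>
                either, since \<open>v0\<close> is adjacent to \<open>v1\<close> only.\<close>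
              have "\<exists>u. (b, u) \<in> parcs T \<and> u \<noteq> v2"
              proof (rule ccontr)
                assume "\<nexists>u. (b, u) \<in> parcs T \<and> u \<noteq> v2"
                then have "{u. (b, u) \<in> parcs T} = {v2}" using t(9)[of b] b by auto
                then have "b \<in> leaves (with_proj T)" "(v2, b) \<in> parcs T"
                  using b t(8)[of b v2] by (auto simp: leaves_iff)
                then show False using ns V by (auto simp: supports_def)
              qed
              then obtain u where u: "(b, u) \<in> parcs T" "u \<noteq> v2" by auto
              moreover have "u \<noteq> v0" using u wx bB by auto
              ultimately show ?thesis using t(6)[OF u(1)] bB by blast
            qed
          qed
          from lower[OF this] have "card A \<le> card (insert v1 (A - {v0, v2}))" .
          also have "\<dots> \<le> Suc (card (A - {v0, v2}))" by (rule card_insert_le_m1) auto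
          also have "card (A - {v0, v2}) = card A - 2"
            using AB path(3) t(10) by (subst card_Diff_subset) auto
          finally have "card A \<le> Suc (card A - 2)" .
          moreover have "2 \<le> card A"
            using card_mono[OF t(10), of "{v0, v2}"] AB path(3) by simp
          ultimately show False by linarith
        qed
        then obtain l where l: "(v2, l) \<in> parcs T" "l \<in> leaves (with_proj T)"
          by (auto simp: supports_def)
        then have l': "{w. (l, w) \<in> parcs T} = {v2}" using t(8) leaves_neighbors by metis
        \<comment> \<open>The leaf survives the deletion: \<open>v0\<close> is attached to
          \<open>v1\<close> instead of \<open>v2\<close>, and \<open>v1\<close> has two neighbours.
          It makes \<open>v2\<close> a support of the remainder as well.\<close>
        have ll: "l \<noteq> v0" "l \<noteq> v1" "l \<in> pverts T"
          using l(1) l' wx(1)[of v2] xw(2)[of v0] V(5) path(3) t(7)[OF l(1)] by auto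
        have lw: "(l, w) \<in> parcs T \<longleftrightarrow> w = v2" for w using l' by auto
        have "{w. (l, w) \<in> parcs ?T} = {v2}" using lw ll V(5) path(3) by auto
        then have "l \<in> leaves (with_proj ?T)" using ll by (auto simp: leaves_iff)
        moreover have "(v2, l) \<in> parcs ?T" using l(1) ll V(5) path(3) by simp
        ultimately have "v2 \<in> supports (with_proj ?T)"
          using V(3,5) path(3) by (auto simp: supports_def)
        then have "constructible (add_pendant (add_pendant ?T v2 v1) v1 v0)
            (insert v0 (A - {v0, v1})) (insert v1 (B - {v0, v1}))"
          using AB V path(3) by (intro constructible.O3[OF cons]) auto
        moreover have "insert v0 (A - {v0, v1}) = A" "insert v1 (B - {v0, v1}) = B"
          using False AB by auto
        ultimately show ?thesis using T by simp
      qed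
    qed
  qed
qed

section \<open>Transfer along isomorphisms\<close>

text \<open>A digraph isomorphism reduced to its vertex map: arcs are pairs of vertices, so the
  vertex map determines the arc map.\<close>

definition is_iso :: "('a \<Rightarrow> 'b) \<Rightarrow> 'a pair_pre_digraph \<Rightarrow> 'b pair_pre_digraph \<Rightarrow> bool" where
  "is_iso f T H \<longleftrightarrow> inj_on f (pverts T) \<and> parcs T \<subseteq> pverts T \<times> pverts T \<and>
     pverts H = f ` pverts T \<and> parcs H = map_prod f f ` parcs T"

lemma is_iso_arc_iff:
  assumes "is_iso f T H" "u \<in> pverts T" "v \<in> pverts T"
  shows "(f u, f v) \<in> parcs H \<longleftrightarrow> (u, v) \<in> parcs T"
proof
  have inj: "inj_on f (pverts T)" and wf: "parcs T \<subseteq> pverts T \<times> pverts T"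
    and E: "parcs H = map_prod f f ` parcs T" using assms(1) by (auto simp: is_iso_def)
  show "(f u, f v) \<in> parcs H" if "(u, v) \<in> parcs T"
    unfolding E using that by (intro image_eqI[of _ _ "(u, v)"]) auto
  assume "(f u, f v) \<in> parcs H"
  then obtain u' v' where e: "(u', v') \<in> parcs T" "f u = f u'" "f v = f v'"
    unfolding E by auto
  then have "u = u'" "v = v'" using inj_onD[OF inj] wf assms(2,3) by blast+
  then show "(u, v) \<in> parcs T" using e(1) by simp
qed

lemma is_iso_if_digraph_iso:
  assumes "digraph_iso (with_proj T) (with_proj H)"
  shows "\<exists>f. is_iso f T H"
proof -
  obtain h where h: "pre_digraph.digraph_isomorphism (with_proj T) h"
    and H: "with_proj H = app_iso h (with_proj T)"
    using assms unfolding digraph_iso_def by auto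
  have wf: "parcs T \<subseteq> pverts T \<times> pverts T"
    using h wf_digraph.wellformed[of "with_proj T"]
    by (fastforce simp: pre_digraph.digraph_isomorphism_def)
  \<comment> \<open>Both graphs have \<open>fst\<close> and \<open>snd\<close> as tail and head
    functions, which forces those of \<open>h\<close> and makes its arc map act
    coordinatewise.\<close>
  have tl: "iso_tail h = fst" "iso_head h = snd" and pv: "pverts H = iso_verts h ` pverts T"
    and pa: "parcs H = iso_arcs h ` parcs T"
    using arg_cong[OF H, of tail] arg_cong[OF H, of head] arg_cong[OF H, of verts]
      arg_cong[OF H, of arcs] by simp_all
  have "iso_arcs h e = map_prod (iso_verts h) (iso_verts h) e" if "e \<in> parcs T" for e
    using h that by (auto simp: pre_digraph.digraph_isomorphism_def tl prod_eq_iff)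
  then have "parcs H = map_prod (iso_verts h) (iso_verts h) ` parcs T" using pa by simp
  then show ?thesis
    using h wf pv unfolding is_iso_def
    by (intro exI[of _ "iso_verts h"]) (simp add: pre_digraph.digraph_isomorphism_def)
qed

lemma digraph_iso_if_is_iso:
  assumes "is_iso f T H"
  shows "digraph_iso (with_proj T) (with_proj H)"
proof -
  note i = assms[unfolded is_iso_def]
  let ?h = "\<lparr>iso_verts = f, iso_arcs = map_prod f f, iso_head = snd, iso_tail = fst\<rparr>"
  have "wf_digraph (with_proj T)" using i by unfold_locales auto
  moreover have "inj_on (map_prod f f) (parcs T)"
    using i by (intro inj_on_subset[OF map_prod_inj_on]) auto
  ultimately have "pre_digraph.digraph_isomorphism (with_proj T) ?h"
    using i by (simp add: pre_digraph.digraph_isomorphism_def)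
  moreover have "with_proj H = app_iso ?h (with_proj T)"
    using i by (simp add: with_proj_def app_iso_def)
  ultimately show ?thesis unfolding digraph_iso_def by blast
qed

lemma is_iso_dominating_set:
  assumes i: "is_iso f T H" and D: "D \<subseteq> pverts T"
  shows "dominating_set (with_proj H) (f ` D) \<longleftrightarrow> dominating_set (with_proj T) D"
proof -
  have V: "pverts H = f ` pverts T" and inj: "inj_on f (pverts T)" using i by (auto simp: is_iso_def)
  have mem: "f v \<in> f ` D \<longleftrightarrow> v \<in> D" if "v \<in> pverts T" for v
    using inj_on_image_mem_iff[OF inj that D] .
  have "(\<exists>u\<in>f ` D. (f v, u) \<in> parcs H) \<longleftrightarrow> (\<exists>u\<in>D. (v, u) \<in> parcs T)" if "v \<in> pverts T" for v
    using is_iso_arc_iff[OF i that] D by blast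
  moreover have "f ` pverts T - f ` D = f ` (pverts T - D)"
    using mem by auto
  moreover have "f ` D \<subseteq> f ` pverts T" using D by auto
  ultimately show ?thesis unfolding dominating_set_iff V using D by simp
qed

lemma is_iso_domination_number:
  assumes i: "is_iso f T H"
  shows "domination_number (with_proj H) = domination_number (with_proj T)"
proof -
  have V: "pverts H = f ` pverts T" and inj: "inj_on f (pverts T)" using i by (auto simp: is_iso_def)
  have card: "card (f ` D) = card D" if "D \<subseteq> pverts T" for D
    using inj that by (intro card_image) (rule inj_on_subset)
  have "(\<exists>D. dominating_set (with_proj H) D \<and> card D = n) \<longleftrightarrow>
      (\<exists>D. dominating_set (with_proj T) D \<and> card D = n)" for n
  proof
    assume "\<exists>D. dominating_set (with_proj H) D \<and> card D = n"
    then obtain D where D: "dominating_set (with_proj H) D" "card D = n" by auto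
    then have "D \<subseteq> f ` pverts T" using V by (simp add: dominating_set_iff)
    then obtain D' where "D' \<subseteq> pverts T" "D = f ` D'" by (meson subset_imageE)
    then show "\<exists>D. dominating_set (with_proj T) D \<and> card D = n"
      using D is_iso_dominating_set[OF i] card by metis
  next
    assume "\<exists>D. dominating_set (with_proj T) D \<and> card D = n"
    then show "\<exists>D. dominating_set (with_proj H) D \<and> card D = n"
      using is_iso_dominating_set[OF i] card by (metis dominating_set_iff)
  qed
  then show ?thesis by (simp add: domination_number_def)
qed

text \<open>The preimage of a closed set of \<open>H\<close> is closed in \<open>T\<close>.\<close>

lemma is_iso_set_connected:
  assumes i: "is_iso f T H" and T: "set_connected T"
  shows "set_connected H"
  unfolding set_connected_def
proof (intro allI impI)
  fix U assume U: "U \<subseteq> pverts H" "U \<noteq> {}" and cl: "\<forall>u\<in>U. \<forall>w. (u, w) \<in> parcs H \<longrightarrow> w \<in> U"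
  have V: "pverts H = f ` pverts T" and wf: "parcs T \<subseteq> pverts T \<times> pverts T"
    using i by (auto simp: is_iso_def)
  have "{v \<in> pverts T. f v \<in> U} = pverts T"
  proof (rule set_connectedD[OF T])
    fix u w assume u: "u \<in> {v \<in> pverts T. f v \<in> U}" "(u, w) \<in> parcs T"
    then have "w \<in> pverts T" using wf by auto
    then show "w \<in> {v \<in> pverts T. f v \<in> U}" using u cl is_iso_arc_iff[OF i, of u w] by auto
  qed (use U V in auto)
  then show "U = pverts H" using U V by auto
qed

lemma is_iso_one_degenerate:
  assumes i: "is_iso f T H" and T: "one_degenerate T"
  shows "one_degenerate H"
  unfolding one_degenerate_def
proof (intro allI impI)
  fix U assume U: "U \<subseteq> pverts H" "U \<noteq> {}"
  have V: "pverts H = f ` pverts T" and inj: "inj_on f (pverts T)" using i by (auto simp: is_iso_def)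
  obtain W where W: "W \<subseteq> pverts T" "U = f ` W" using U(1) V by (auto elim: subset_imageE)
  then obtain v where v: "v \<in> W" "card {u \<in> W. (v, u) \<in> parcs T} \<le> 1"
    using T U unfolding one_degenerate_def by (metis image_empty)
  have "{u \<in> U. (f v, u) \<in> parcs H} = f ` {u \<in> W. (v, u) \<in> parcs T}"
    using W v is_iso_arc_iff[OF i] by blast
  moreover have "inj_on f {u \<in> W. (v, u) \<in> parcs T}" using inj W by (auto intro: inj_on_subset)
  ultimately have "card {u \<in> U. (f v, u) \<in> parcs H} \<le> 1" using v by (simp add: card_image)
  then show "\<exists>v\<in>U. card {u \<in> U. (v, u) \<in> parcs H} \<le> 1" using v W by blast
qed

lemma is_iso_bigraph:
  assumes i: "is_iso f T H" and T: "bigraph T A B"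
  shows "bigraph H (f ` A) (f ` B)"
proof -
  note t = bigraphD[OF T]
  have V: "pverts H = f ` pverts T" and inj: "inj_on f (pverts T)"
    and E: "parcs H = map_prod f f ` parcs T" using i by (auto simp: is_iso_def)
  have "f ` A \<inter> f ` B = {}"
    using inj_on_image_Int[OF inj, of A B] t(2,3) by auto
  moreover have "parcs H \<subseteq> f ` A \<times> f ` B \<union> f ` B \<times> f ` A"
    using T unfolding E bigraph_def by fastforce
  moreover have "sym (parcs H)"
    unfolding sym_def E using t(8) by fastforce
  moreover have "\<exists>u. (v, u) \<in> parcs H" if "v \<in> pverts H" for v
    using that t(9) unfolding V E by fastforce
  ultimately show ?thesis
    unfolding bigraph_def using V t(1,2) by (auto simp: image_Un[symmetric])
qed

text \<open>Properties are transported forward along an isomorphism, while membership in the family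
  provides a map from \<open>T\<close> to the constructed tree; this reverses it.\<close>

lemma is_iso_the_inv_into:
  assumes "is_iso f T H"
  shows "is_iso (the_inv_into (pverts T) f) H T"
proof -
  note i = assms[unfolded is_iso_def]
  let ?g = "the_inv_into (pverts T) f"
  have g: "?g (f v) = v" if "v \<in> pverts T" for v using i that by (simp add: the_inv_into_f_f)
  have "map_prod ?g ?g ` map_prod f f ` parcs T = (\<lambda>e. e) ` parcs T"
    unfolding image_image using i g by (intro image_cong) auto
  then show ?thesis
    using i unfolding is_iso_def
    by (auto simp: inj_on_the_inv_into the_inv_into_onto image_image g)
qed

section \<open>The characterization\<close>

theorem theorem11:
  fixes T :: "'a pair_pre_digraph"
  assumes "undirected_tree T"
  shows "T \<in> T_max \<longleftrightarrow> T \<in> T_family"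
proof -
  interpret pair_graph T using assms by (simp add: undirected_tree_def)
  have conn: "connected (with_proj T)" and acyc: "\<not> (\<exists>p. cycle p \<and> 3 \<le> length p)"
    using assms by (auto simp: undirected_tree_def)
  have sc: "set_connected T" by (rule set_connected_if_connected[OF conn])
  have od: "one_degenerate T" by (rule one_degenerate_if_acyclic[OF acyc])
  have ne: "pverts T \<noteq> {}"
    using conn by (auto simp: connected_def strongly_connected_def mk_symmetric_def)
  show ?thesis
  proof
    assume "T \<in> T_max"
    then obtain A0 B0 where AB0: "bipartition (with_proj T) A0 B0"
      "domination_number (with_proj T) = min (card A0) (card B0)"
      by (auto simp: T_max_def)
    \<comment> \<open>The smaller part is to become the first one, so the parts may have to be
      swapped.\<close>
    have "bipartition (with_proj T) B0 A0"
      using AB0(1) arcs_symmetric by (fastforce simp: bipartition_def)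
    then obtain A B where AB: "bipartition (with_proj T) A B" "domination_number (with_proj T) = card A" "card A \<le> card B"
      using AB0 by (cases "card A0 \<le> card B0") (auto simp: min_def)
    \<comment> \<open>The one-vertex tree has domination number one but an empty smaller part. A
      nonempty dominating set makes both parts nonempty and so yields two distinct vertices.\<close>
    obtain D where D: "dominating_set (with_proj T) D" "card D = card A"
      using domination_number_attained AB(2) by metis
    then have "D \<noteq> {}" "finite D"
      using ne pair_finite_verts by (auto simp: dominating_set_iff intro: finite_subset)
    then have "0 < card A" "0 < card B" using D AB(3) card_gt_0_iff[of D] by linarith+
    then have "A \<noteq> {}" "B \<noteq> {}" by auto
    then obtain a b where "a \<in> pverts T" "b \<in> pverts T" "a \<noteq> b"
      using AB(1) by (auto simp: bipartition_def)
    then have "\<exists>u. (v, u) \<in> parcs T" if "v \<in> pverts T" for v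
      using set_connected_no_isolated[OF sc that] by metis
    moreover have "parcs T \<subseteq> A \<times> B \<union> B \<times> A"
    proof (intro subrelI)
      fix u v assume uv: "(u, v) \<in> parcs T"
      then have "(v, u) \<in> parcs T" by (rule arcs_symmetric)
      with uv show "(u, v) \<in> A \<times> B \<union> B \<times> A"
        using AB(1) in_arcsD1[OF uv] by (auto simp: bipartition_def)
    qed
    ultimately have big: "bigraph T A B"
      using AB(1) pair_finite_verts arcs_symmetric
      by (auto simp: bigraph_def bipartition_def sym_def)
    \<comment> \<open>The family is built on natural numbers, so the finite vertex set is relabelled
      injectively.\<close>
    obtain f :: "'a \<Rightarrow> nat" where f: "inj_on f (pverts T)"
      using finite_imp_inj_to_nat_seg[OF pair_finite_verts] by auto
    define H where "H = \<lparr>pverts = f ` pverts T, parcs = map_prod f f ` parcs T\<rparr>"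
    have iso: "is_iso f T H"
      using f in_arcsD1 in_arcsD2 by (auto simp: is_iso_def H_def)
    have "card (f ` A) = card A"
      using f bigraphD(2)[OF big] by (intro card_image) (auto intro: inj_on_subset)
    then have "constructible H (f ` A) (f ` B)"
      using is_iso_bigraph[OF iso big] is_iso_set_connected[OF iso sc]
        is_iso_one_degenerate[OF iso od] is_iso_domination_number[OF iso] AB(2) ne
      by (intro constructible_complete) (auto simp: H_def)
    then show "T \<in> T_family"
      using digraph_iso_if_is_iso[OF iso] by (auto simp: T_family_def)
  next
    assume "T \<in> T_family"
    then obtain H :: "nat pair_pre_digraph" and A B where H: "constructible H A B"
      and "digraph_iso (with_proj T) (with_proj H)" by (auto simp: T_family_def)
    then obtain f where "is_iso f T H" using is_iso_if_digraph_iso by blast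
    then have iso: "is_iso (the_inv_into (pverts T) f) H T" (is "is_iso ?g H T")
      by (rule is_iso_the_inv_into)
    have big: "bigraph H A B" and dn: "domination_number (with_proj H) = card A"
      using constructible_sound[OF H] by auto
    note h = bigraphD[OF big]
    have bigT: "bigraph T (?g ` A) (?g ` B)" by (rule is_iso_bigraph[OF iso big])
    then have bigT': "bigraph T (?g ` B) (?g ` A)" by (rule bigraph_swap)
    have "card (?g ` A) = card A"
      using iso h(2) by (intro card_image) (auto simp: is_iso_def intro: inj_on_subset)
    then have "domination_number (with_proj T) = card (?g ` A)"
      using dn is_iso_domination_number[OF iso] by simp
    \<comment> \<open>The second part dominates as well, so the first part cannot be the larger
      one.\<close>
    then have "domination_number (with_proj T) = min (card (?g ` A)) (card (?g ` B))"
      using bigraph_domination_number_le[OF bigT'] by simp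
    moreover have "bipartition (with_proj T) (?g ` A) (?g ` B)"
      using bigraphD[OF bigT] unfolding bipartition_def by auto
    ultimately show "T \<in> T_max" using assms by (auto simp: T_max_def)
  qed
qed

end
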